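(* Let $\lambda\in(0,1)$. Then for all $z\in\mathbb{C}$ with $z\notin\{0,-1,-2,\dots,\frac{1}{\lambda},\frac{1}{\lambda}+1,\frac{1}{\lambda}+2,\dots\}$, $$\Gamma_{\lambda}(z)=\frac{\lambda^{-z}}{z\left(\frac{1}{\lambda}-z\right)}\frac{1}{\Gamma\left(\frac{1}{\lambda}\right)}e^{-\frac{\gamma}{\lambda}}\prod_{n=1}^{\infty}\left\{e^{\frac{1}{n\lambda}}\left(1+\frac{z}{n}\right)^{-1}\left(1+\frac{\frac{1}{\lambda}-z}{n}\right)^{-1}\right\}$$ $$=\frac{\lambda^{-z}}{z\left(\frac{1}{\lambda}-z\right)}\frac{1}{\Gamma\left(\frac{1}{\lambda}\right)}\prod_{n=1}^{\infty}\left\{\left(1+\frac{1}{n}\right)^{\frac{1}{\lambda}}\left(1+\frac{z}{n}\right)^{-1}\left(1+\frac{\frac{1}{\lambda}-z}{n}\right)^{-1}\right\}.$$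
   Context: For $\lambda\in(0,1)$ the degenerate gamma function is defined for $0<\operatorname{Re}(s)<\frac1\lambda$ by $\Gamma_{\lambda}(s)=\int_0^\infty (1+\lambda t)^{-\frac{1}{\lambda}}t^{s-1}dt$; it extends to a meromorphic function on $\mathbb{C}$ given by $\Gamma_\lambda(s)=\lambda^{-s}\Gamma(s)\Gamma(\frac1\lambda-s)/\Gamma(\frac1\lambda)$, where $\Gamma$ is the usual gamma function. $\Gamma_\lambda$ denotes this continuation. $\gamma=\lim_{n\to\infty}(1+\frac12+\cdots+\frac1n-\log n)$ is Euler's constant. *)

theory Defs
  imports "HOL-Complex_Analysis.Complex_Analysis"
begin

definition degenerate_Gamma_integral :: "real \<Rightarrow> complex \<Rightarrow> complex" where
  "degenerate_Gamma_integral lam s =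
     integral {0<..} (\<lambda>t::real. of_real ((1 + lam * t) powr (- 1 / lam)) * of_real t powr (s - 1))"

text \<open>
  The meromorphic continuation of the integral from the strip to the whole plane. Being
  \<^emph>\<open>nicely\<close> meromorphic (every singularity is a pole, where the value is the
  conventional \<open>0\<close>) fixes the values at all points, so the continuation is unique
  as a total function. It is \<open>\<lambda>s. lam powr (-s) * Gamma s * Gamma (1 / lam - s) / Gamma (1 / lam)\<close>.
\<close>
definition degenerate_Gamma :: "real \<Rightarrow> complex \<Rightarrow> complex" where
  "degenerate_Gamma lam =
     (THE f. f nicely_meromorphic_on UNIV \<and>
             (\<forall>s. 0 < Re s \<and> Re s < 1 / lam \<longrightarrow> f s = degenerate_Gamma_integral lam s))"

end

theory Submission
  imports Defs
begin

text \<open>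
  Put \<open>a = 1/lam\<close>. Writing \<open>Gamma a * (1 + lam * t) powr (-a)\<close> as the integral over
  \<open>x > 0\<close> of \<open>x powr (a - 1) * exp (- (x * (1 + lam * t)))\<close> and exchanging the order of
  integration turns the defining integral into
  \<open>lam powr (-s) * Gamma s * Gamma (a - s) / Gamma a\<close>. This is the reciprocal of an entire
  function, hence nicely meromorphic, and by the identity theorem it is the continuation.
  Multiplying the Weierstrass products (respectively the Euler products) of \<open>Gamma z\<close> and
  \<open>Gamma (a - z)\<close> gives the two product formulas, because \<open>z + (a - z) = a\<close>.
\<close>

section \<open>Evaluation of the integral on the strip\<close>

lemma borel_measurable_indicator_powr [measurable]:
  "(\<lambda>t::real. indicator {0<..} t *\<^sub>R (of_real t powr w :: complex)) \<in> borel_measurable borel"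
proof -
  have "(\<lambda>t::real. indicator {0<..} t *\<^sub>R (of_real t powr w :: complex)) =
        (\<lambda>t. indicator {0<..} t *\<^sub>R exp (w * of_real (ln t)))"
    by (auto simp: fun_eq_iff indicator_def powr_def Ln_of_real)
  thus ?thesis by simp
qed

text \<open>Substitute c * t for t in Euler's integral. The rate c is kept general because the
  double integral below uses it with \<open>lam * x\<close>, \<open>1 + lam * t\<close> and
  1.\<close>

lemma has_bochner_integral_Gamma_scaled:
  fixes w :: complex and c :: real
  assumes w: "Re w > 0" and c: "c > 0"
  shows "has_bochner_integral lborel
           (\<lambda>t. indicator {0<..} t *\<^sub>R (of_real t powr (w - 1)) * of_real (exp (- (c * t))))
           (Gamma w * of_real c powr (- w))"
proof -
  let ?f = "\<lambda>t. indicator {0<..} t *\<^sub>R (of_real t powr (w - 1)) * of_real (exp (- t)) :: complex"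
  have eq: "?f = (\<lambda>t. indicator {0<..} t *\<^sub>R (of_real t powr (w - 1) / of_real (exp t)))"
    by (auto simp: fun_eq_iff exp_minus field_simps)
  have meas: "?f \<in> borel_measurable borel"
    by measurable
  \<comment> \<open>Borel measurability carries integrability from \<open>lebesgue\<close> over to
    \<open>lborel\<close>, where the affine substitution and Fubini are applied.\<close>
  have "integrable lebesgue ?f"
    using absolutely_integrable_Gamma_integral'[OF w] unfolding eq set_integrable_def .
  hence int: "integrable lborel ?f"
    using meas integrable_completion[of ?f lborel] by simp
  hence si: "set_integrable lborel {0<..} (\<lambda>t. of_real t powr (w - 1) / of_real (exp t) :: complex)"
    unfolding eq set_integrable_def .
  have "integral\<^sup>L lborel ?f = Gamma w"
    using set_borel_integral_eq_integral(2)[OF si] integral_unique[OF Gamma_integral_complex'[OF w]]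
    unfolding eq set_lebesgue_integral_def by simp
  with int have "has_bochner_integral lborel ?f (Gamma w)"
    by (simp add: has_bochner_integral_iff)
  hence "has_bochner_integral lborel (\<lambda>t. ?f (0 + c * t)) (Gamma w /\<^sub>R \<bar>c\<bar>)"
    using c by (subst (asm) lborel_has_bochner_integral_real_affine_iff[of c _ _ 0]) auto
  \<comment> \<open>The new factor cancels c^(w-1) in (c t)^(w-1); with the Jacobian 1/c it leaves
    c^(-w).\<close>
  hence "has_bochner_integral lborel (\<lambda>t. of_real c powr (1 - w) * ?f (0 + c * t))
           (of_real c powr (1 - w) * (Gamma w /\<^sub>R \<bar>c\<bar>))"
    by (rule has_bochner_integral_mult_right)
  also have "(\<lambda>t. of_real c powr (1 - w) * ?f (0 + c * t)) =
      (\<lambda>t. indicator {0<..} t *\<^sub>R (of_real t powr (w - 1)) * of_real (exp (- (c * t))))"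
  proof
    fix t :: real
    have "complex_of_real c powr (1 - w) * (complex_of_real (c * t) powr (w - 1)) = of_real t powr (w - 1)"
      if "t > 0"
      using that c by (auto simp: powr_def Ln_of_real ln_mult exp_add[symmetric] algebra_simps
            simp del: of_real_mult)
    thus "of_real c powr (1 - w) * ?f (0 + c * t) =
        indicator {0<..} t *\<^sub>R (of_real t powr (w - 1)) * of_real (exp (- (c * t)))"
      using c by (auto simp: indicator_def zero_less_mult_iff mult.assoc[symmetric])
  qed
  also have "of_real c powr (1 - w) * (Gamma w /\<^sub>R \<bar>c\<bar>) = Gamma w * of_real c powr (- w)"
    using c by (simp add: scaleR_conv_of_real powr_diff powr_minus field_simps)
  finally show ?thesis .
qed

lemma degenerate_Gamma_integral_eq:
  fixes lam :: real and s :: complex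
  assumes lam: "lam > 0" and s: "0 < Re s" "Re s < 1 / lam"
  shows "degenerate_Gamma_integral lam s =
           of_real lam powr (- s) * Gamma s * Gamma (of_real (1 / lam) - s) / Gamma (of_real (1 / lam))"
proof -
  define a where "a = complex_of_real (1 / lam)"
  have a: "Re a > 0" "Re (a - s) > 0"
    using assms by (auto simp: a_def)
  define h where "h = (\<lambda>(w::complex) (t::real). indicator {0<..} t *\<^sub>R (of_real t powr (w - 1)))"
  define g where "g = (\<lambda>t. complex_of_real ((1 + lam * t) powr (- 1 / lam)) * of_real t powr (s - 1))"
  \<comment> \<open>The double integrand. Since \<open>h\<close> vanishes off the positive axis,
    both variables may range over all of \<open>lborel\<close>.\<close>
  define f where "f = (\<lambda>w (x, t). h w t * h a x * of_real (exp (- (x * (1 + lam * t)))))"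
  have [measurable]: "h w \<in> borel_measurable borel" for w
    unfolding h_def by measurable
  have f_meas: "f s \<in> borel_measurable (lborel \<Otimes>\<^sub>M lborel)"
    unfolding f_def by measurable
  \<comment> \<open>Integrating over t is the scaled Gamma integral with rate
    \<open>lam * x\<close>; its factor x^(-w) turns x^(a-1) into x^(a-w-1). A general
    \<open>w\<close> allows reuse at \<open>Re s\<close>.\<close>
  have inner_t: "has_bochner_integral lborel (\<lambda>t. f w (x, t))
          (of_real lam powr (- w) * Gamma w * (h (a - w) x * of_real (exp (- x))))" if w: "Re w > 0" for x w
  proof (cases "x > 0")
    case True
    have "has_bochner_integral lborel (\<lambda>t. h a x * of_real (exp (-x)) * (h w t * of_real (exp (- (lam * x * t)))))
        (h a x * of_real (exp (-x)) * (Gamma w * of_real (lam * x) powr (- w)))"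
      unfolding h_def using True lam w
      by (intro has_bochner_integral_mult_right has_bochner_integral_Gamma_scaled) auto
    also have "h a x * of_real (exp (-x)) * (Gamma w * of_real (lam * x) powr (- w)) =
       of_real lam powr (- w) * Gamma w * (h (a - w) x * of_real (exp (- x)))"
      using True lam
      by (simp add: h_def powr_def Ln_of_real ln_mult exp_add[symmetric] algebra_simps del: of_real_mult)
    also have "(\<lambda>t. h a x * of_real (exp (-x)) * (h w t * of_real (exp (- (lam * x * t))))) = (\<lambda>t. f w (x, t))"
      by (auto simp: f_def fun_eq_iff exp_add[symmetric] exp_of_real algebra_simps exp_diff exp_minus divide_inverse)
    finally show ?thesis .
  qed (auto simp: f_def h_def)
  have outer_x: "has_bochner_integral lborel (\<lambda>x. h (a - w) x * of_real (exp (- x))) (Gamma (a - w))"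
    if "Re (a - w) > 0" for w
    using has_bochner_integral_Gamma_scaled[OF that zero_less_one] by (simp add: h_def)
  \<comment> \<open>In the other order the rate is \<open>1 + lam * t\<close>, which recovers the
    integrand \<open>g\<close> of the definition.\<close>
  have inner_x: "has_bochner_integral lborel (\<lambda>x. f s (x, t))
          (Gamma a * (indicator {0<..} t *\<^sub>R g t))" for t
  proof (cases "t > 0")
    case True
    have pos: "1 + lam * t > 0"
      using True lam by (simp add: pos_add_strict)
    have "has_bochner_integral lborel (\<lambda>x. h s t * (h a x * of_real (exp (- ((1 + lam * t) * x)))))
        (h s t * (Gamma a * of_real (1 + lam * t) powr (- a)))"
      unfolding h_def using a pos
      by (intro has_bochner_integral_mult_right has_bochner_integral_Gamma_scaled) auto
    moreover have "complex_of_real (1 + lam * t) powr (- a) = of_real ((1 + lam * t) powr (- 1 / lam))"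
      using powr_of_real[of "1 + lam * t" "- 1 / lam"] pos by (simp add: a_def)
    ultimately show ?thesis
      using True by (simp add: f_def h_def g_def mult_ac)
  qed (auto simp: f_def h_def)
  have norm_h: "norm (h w t) = h (of_real (Re w)) t" for w t
    by (auto simp: h_def indicator_def norm_powr_real_powr powr_of_real[symmetric])
  \<comment> \<open>As \<open>a\<close> is real, taking norms only replaces \<open>s\<close> by
    \<open>Re s\<close>, so absolute integrability follows from the same two integrals.\<close>
  have norm_f: "complex_of_real (norm (f s (x, t))) = f (of_real (Re s)) (x, t)" for x t
    using norm_h[of a x] by (simp add: f_def norm_mult norm_h a_def)
  have int: "integrable (lborel \<Otimes>\<^sub>M lborel) (f s)"
  proof (rule lborel_pair.Fubini_integrable[OF f_meas])
    show "AE x in lborel. integrable lborel (\<lambda>t. f s (x, t))"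
      using inner_t[of s] s by (auto simp: has_bochner_integral_iff)
    have eq: "complex_of_real (LINT t|lborel. norm (f s (x, t))) =
        of_real lam powr (- of_real (Re s)) * Gamma (of_real (Re s)) *
          (h (a - of_real (Re s)) x * of_real (exp (- x)))" for x
      unfolding integral_complex_of_real[symmetric] norm_f
      using inner_t[of "of_real (Re s)"] s by (simp add: has_bochner_integral_iff)
    have "integrable lborel (\<lambda>x. complex_of_real (LINT t|lborel. norm (f s (x, t))))"
      unfolding eq using outer_x[of "of_real (Re s)"] a by (simp add: has_bochner_integral_iff)
    thus "integrable lborel (\<lambda>x. LINT t|lborel. norm (f s (x, t)))"
      by (simp add: complex_of_real_integrable_eq)
  qed
  have Ga: "Gamma a \<noteq> 0"
    using a by (auto simp: Gamma_eq_zero_iff elim!: nonpos_Ints_cases')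
  have "integrable lborel (\<lambda>t. Gamma a * (indicator {0<..} t *\<^sub>R g t))"
    using lborel_pair.integrable_snd[of "\<lambda>x t. f s (x, t)"] int by (simp add: inner_x[THEN has_bochner_integral_integral_eq])
  \<comment> \<open>This identifies the gauge integral of the definition with a Lebesgue
    integral.\<close>
  hence g_int: "set_integrable lborel {0<..} g"
    using integrable_mult_right[of "inverse (Gamma a)" lborel] Ga
    by (fastforce simp: set_integrable_def mult.assoc[symmetric] simp del: mult_scaleR_right)
  have "Gamma a * degenerate_Gamma_integral lam s = Gamma a * (LINT t:{0<..}|lborel. g t)"
    using set_borel_integral_eq_integral(2)[OF g_int]
    by (simp add: degenerate_Gamma_integral_def g_def)
  also have "\<dots> = (LINT t|lborel. LINT x|lborel. f s (x, t))"
    by (simp add: inner_x[THEN has_bochner_integral_integral_eq] set_lebesgue_integral_def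
        del: mult_scaleR_right)
  also have "\<dots> = (LINT x|lborel. LINT t|lborel. f s (x, t))"
    using lborel_pair.Fubini_integral[of "\<lambda>x t. f s (x, t)"] int by simp
  also have "\<dots> = (LINT x|lborel. of_real lam powr (- s) * Gamma s * (h (a - s) x * of_real (exp (- x))))"
    using inner_t[of s] s by (simp add: has_bochner_integral_iff)
  also have "\<dots> = of_real lam powr (- s) * Gamma s * Gamma (a - s)"
    using outer_x[of s] a by (simp add: has_bochner_integral_iff)
  finally show ?thesis
    using Ga by (simp add: a_def field_simps)
qed

section \<open>Uniqueness and closed form of the continuation\<close>

lemma nicely_meromorphic_eqI:
  fixes f g :: "complex \<Rightarrow> complex"
  assumes f: "f nicely_meromorphic_on UNIV" and g: "g nicely_meromorphic_on UNIV"
    and U: "open U" "U \<noteq> {}" "\<And>s. s \<in> U \<Longrightarrow> f s = g s"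
  shows "f = g"
proof
  fix z :: complex
  obtain u where u: "u \<in> U" using U by blast
  \<comment> \<open>The plain difference may have a wrong value at a singularity of \<open>f\<close>
    or \<open>g\<close>; removing singularities makes the identity theorem applicable.\<close>
  define d where "d = remove_sings (\<lambda>s. f s - g s)"
  have mero: "(\<lambda>s. f s - g s) meromorphic_on UNIV"
    using f g by (auto simp: nicely_meromorphic_on_def intro!: meromorphic_intros)
  have nice: "d nicely_meromorphic_on UNIV"
    unfolding d_def by (rule remove_sings_nicely_meromorphic[OF mero])
  have ev_d: "eventually (\<lambda>s. d s = f s - g s) (at x)" for x
    unfolding d_def using mero
    by (intro eventually_remove_sings_eq_at meromorphic_on_isolated_singularity)
       (auto elim: meromorphic_on_subset)
  have "eventually (\<lambda>s. s \<in> U) (at u)"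
    using U u by (intro eventually_at_in_open') auto
  with ev_d[of u] have "eventually (\<lambda>s. d s = 0) (at u)"
    by eventually_elim (use U in auto)
  hence "frequently (\<lambda>s. d s = 0) (at u)"
    by (intro eventually_frequently) auto
  from frequently_eq_meromorphic_imp_constant[OF this nice] have "d s = 0" for s
    by auto
  \<comment> \<open>Agreement on a punctured neighbourhood gives the same poles and limits, and
    niceness then fixes the value at \<open>z\<close>: 0 at a pole, the limit elsewhere.\<close>
  with ev_d[of z] have ev: "eventually (\<lambda>s. f s = g s) (at z)"
    by simp
  hence pole: "is_pole f z \<longleftrightarrow> is_pole g z"
    by (intro is_pole_cong) auto
  have lim: "f \<midarrow>z\<rightarrow> c \<longleftrightarrow> g \<midarrow>z\<rightarrow> c" for c
    using ev by (intro filterlim_cong) auto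
  have "is_pole f z \<and> f z = 0 \<or> f \<midarrow>z\<rightarrow> f z" "is_pole g z \<and> g z = 0 \<or> g \<midarrow>z\<rightarrow> g z"
    using f g by (auto simp: nicely_meromorphic_on_def)
  thus "f z = g z"
    using pole lim not_tendsto_and_filterlim_at_infinity[of "at z" f]
      not_tendsto_and_filterlim_at_infinity[of "at z" g]
    unfolding is_pole_def by (metis LIM_unique trivial_limit_at)
qed

lemma degenerate_Gamma_eq:
  fixes lam :: real
  assumes lam: "lam > 0"
  shows "degenerate_Gamma lam =
    (\<lambda>s. of_real lam powr (- s) * Gamma s * Gamma (of_real (1 / lam) - s) / Gamma (of_real (1 / lam)))"
    (is "_ = ?G")
  unfolding degenerate_Gamma_def
proof (rule the_equality)
  \<comment> \<open>This holds at the poles too: \<open>Gamma\<close> is the inverse of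
    \<open>rGamma\<close>, and \<open>inverse 0 = 0\<close>.\<close>
  have "?G = (\<lambda>s. inverse (of_real lam powr s * rGamma s * rGamma (of_real (1 / lam) - s) * Gamma (of_real (1 / lam))))"
    using lam by (auto simp: fun_eq_iff powr_minus Gamma_def field_simps)
  moreover have "\<dots> nicely_meromorphic_on UNIV"
    using lam by (intro nicely_meromorphic_on_inverse analytic_on_imp_nicely_meromorphic_on analytic_intros)
      (auto intro!: analytic_intros)
  ultimately have G: "?G nicely_meromorphic_on UNIV"
    by simp
  thus *: "?G nicely_meromorphic_on UNIV \<and>
     (\<forall>s. 0 < Re s \<and> Re s < 1 / lam \<longrightarrow> ?G s = degenerate_Gamma_integral lam s)"
    using lam degenerate_Gamma_integral_eq by auto
  fix f
  assume f: "f nicely_meromorphic_on UNIV \<and>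
     (\<forall>s. 0 < Re s \<and> Re s < 1 / lam \<longrightarrow> f s = degenerate_Gamma_integral lam s)"
  show "f = ?G"
  proof (rule nicely_meromorphic_eqI[OF _ G])
    show "open {s. 0 < Re s \<and> Re s < 1 / lam}"
      by (intro open_Collect_conj open_Collect_less continuous_intros)
    have "of_real (1 / (2 * lam)) \<in> {s. 0 < Re s \<and> Re s < 1 / lam}"
      using lam by (simp add: field_simps)
    thus "{s. 0 < Re s \<and> Re s < 1 / lam} \<noteq> {}"
      by blast
  qed (use f * in auto)
qed

section \<open>The two product formulas\<close>

text \<open>Bridges the products over 1..n in the Gamma series and the zero-based
  \<open>has_prod\<close>, which also demands a nonzero limit.\<close>

lemma has_prod_SucI:
  fixes f :: "nat \<Rightarrow> 'a :: {t2_space, comm_semiring_1}"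
  assumes "(\<lambda>n. \<Prod>k=1..n. f k) \<longlonglongrightarrow> p" "p \<noteq> 0"
  shows "(\<lambda>n. f (Suc n)) has_prod p"
proof -
  have "(\<lambda>n. \<Prod>k=1..Suc n. f k) \<longlonglongrightarrow> p"
    using assms(1) by (rule LIMSEQ_Suc)
  also have "(\<lambda>n. \<Prod>k=1..Suc n. f k) = (\<lambda>n. \<Prod>k\<le>n. f (Suc k))"
    unfolding atMost_atLeast0 One_nat_def
    by (subst prod.shift_bounds_cl_Suc_ivl) simp
  finally show ?thesis
    using assms(2) by (simp add: has_prod_def raw_has_prod_def)
qed

theorem theorem2p4:
  fixes lam :: real and z :: complex
  assumes "0 < lam" and "lam < 1"
    and "\<forall>k::nat. z \<noteq> - of_nat k"
    and "\<forall>k::nat. z \<noteq> of_real (1 / lam) + of_nat k"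
  defines "P \<equiv> (\<lambda>n::nat. exp (of_real (1 / (real n * lam))) * inverse (1 + z / of_nat n)
                   * inverse (1 + (of_real (1 / lam) - z) / of_nat n))"
    and "Q \<equiv> (\<lambda>n::nat. of_real ((1 + 1 / real n) powr (1 / lam)) * inverse (1 + z / of_nat n)
                   * inverse (1 + (of_real (1 / lam) - z) / of_nat n))"
  shows "convergent_prod (\<lambda>n. P (Suc n))
       \<and> degenerate_Gamma lam z =
           of_real lam powr (- z) / (z * (of_real (1 / lam) - z)) * (1 / Gamma (of_real (1 / lam)))
             * exp (- (euler_mascheroni / of_real lam)) * (\<Prod>n. P (Suc n))
       \<and> convergent_prod (\<lambda>n. Q (Suc n))
       \<and> degenerate_Gamma lam z =
           of_real lam powr (- z) / (z * (of_real (1 / lam) - z)) * (1 / Gamma (of_real (1 / lam)))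
             * (\<Prod>n. Q (Suc n))"
proof -
  define a where "a = complex_of_real (1 / lam)"
  define E where "E = exp (- (euler_mascheroni / complex_of_real lam))"
  have z: "z \<notin> \<int>\<^sub>\<le>\<^sub>0"
    using assms(3) by (auto elim!: nonpos_Ints_cases')
  have az: "a - z \<notin> \<int>\<^sub>\<le>\<^sub>0"
  proof
    assume "a - z \<in> \<int>\<^sub>\<le>\<^sub>0"
    then obtain k where "a - z = - of_nat k" by (elim nonpos_Ints_cases')
    hence "z = a + of_nat k" by (simp add: algebra_simps)
    thus False using assms(4) by (auto simp: a_def)
  qed
  have nz: "z \<noteq> 0" "a - z \<noteq> 0"
    using z az by auto
  \<comment> \<open>The product of the \<open>Q\<close> factors will be \<open>G\<close>, that of
    the \<open>P\<close> factors \<open>G / E\<close>. Both are nonzero because Gamma has no zeros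
    off its poles.\<close>
  define G where "G = z * (a - z) * (Gamma z * Gamma (a - z))"
  have G: "G \<noteq> 0"
    using nz z az by (simp add: G_def Gamma_eq_zero_iff)
  have E: "E \<noteq> 0" by (simp add: E_def)

  \<comment> \<open>The scalar cancels the prefactors of the two Weierstrass series: their
    denominators are z and a - z, and their exponentials multiply to \<open>E\<close>.\<close>
  have "(\<lambda>n. z * (a - z) / E * (Gamma_series_Weierstrass z n * Gamma_series_Weierstrass (a - z) n))
          \<longlonglongrightarrow> z * (a - z) / E * (Gamma z * Gamma (a - z))"
    by (intro tendsto_intros Gamma_Weierstrass_complex)
  also have "(\<lambda>n. z * (a - z) / E * (Gamma_series_Weierstrass z n * Gamma_series_Weierstrass (a - z) n)) =
             (\<lambda>n. \<Prod>k=1..n. P k)"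
  proof
    fix n
    have "exp (- euler_mascheroni * z) * exp (- euler_mascheroni * (a - z)) = E"
      unfolding E_def exp_add[symmetric] by (simp add: a_def algebra_simps)
    \<comment> \<open>The exponents z/k and (a-z)/k add up to 1/(k lam); at k = 0 all of them are 0
      by convention.\<close>
    moreover have "P k = (exp (z / of_nat k) / (1 + z / of_nat k)) *
                     (exp ((a - z) / of_nat k) / (1 + (a - z) / of_nat k))" for k
    proof -
      have "exp (of_real (1 / (real k * lam))) = exp (z / of_nat k) * exp ((a - z) / of_nat k)"
        unfolding exp_add[symmetric] by (simp add: a_def add_divide_distrib[symmetric] mult.commute)
      thus ?thesis by (simp add: P_def a_def divide_inverse mult_ac)
    qed
    moreover have "z * (a - z) / E * ((e1 / z * X) * (e2 / (a - z) * Y)) = X * Y"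
      if "e1 * e2 = E" for e1 e2 X Y
      using nz E unfolding that[symmetric] by simp
    ultimately show "z * (a - z) / E * (Gamma_series_Weierstrass z n * Gamma_series_Weierstrass (a - z) n) =
       (\<Prod>k=1..n. P k)"
      by (simp only: Gamma_series_Weierstrass_def prod.distrib)
  qed
  finally have P: "(\<lambda>n. P (Suc n)) has_prod (G / E)"
    using G E by (intro has_prod_SucI) (simp_all add: G_def)

  have "(\<lambda>n. z * (a - z) * (Gamma_series_euler' z n * Gamma_series_euler' (a - z) n))
          \<longlonglongrightarrow> z * (a - z) * (Gamma z * Gamma (a - z))"
    by (intro tendsto_intros Gamma_series_euler' z az)
  also have "(\<lambda>n. z * (a - z) * (Gamma_series_euler' z n * Gamma_series_euler' (a - z) n)) =
             (\<lambda>n. \<Prod>k=1..n. Q k)"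
  proof
    fix n
    \<comment> \<open>The powers of 1 + 1/k with exponents z and a - z combine to the real power
      with exponent 1/lam.\<close>
    have "(\<Prod>k=1..n. Q k) = (\<Prod>k=1..n. (exp (z * of_real (ln (1 + inverse (of_nat k)))) / (1 + z / of_nat k)) *
                     (exp ((a - z) * of_real (ln (1 + inverse (of_nat k)))) / (1 + (a - z) / of_nat k)))"
    proof (rule prod.cong)
      fix k assume "k \<in> {1..n}"
      hence "1 + 1 / real k > 0" by (simp add: add_pos_pos)
      hence "complex_of_real ((1 + 1 / real k) powr (1 / lam)) =
               exp (of_real (1 / lam * ln (1 + 1 / real k)))"
        by (simp add: powr_def flip: exp_of_real)
      also have "\<dots> = exp (z * of_real (ln (1 + inverse (of_nat k)))) *
                      exp ((a - z) * of_real (ln (1 + inverse (of_nat k))))"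
        unfolding exp_add[symmetric] by (simp add: a_def algebra_simps inverse_eq_divide)
      finally show "Q k = (exp (z * of_real (ln (1 + inverse (of_nat k)))) / (1 + z / of_nat k)) *
                     (exp ((a - z) * of_real (ln (1 + inverse (of_nat k)))) / (1 + (a - z) / of_nat k))"
        by (simp add: Q_def a_def divide_inverse mult_ac)
    qed auto
    moreover have "z * (a - z) * ((inverse z * X) * (inverse (a - z) * Y)) = X * Y" for X Y
      using nz by (simp add: inverse_eq_divide)
    ultimately show "z * (a - z) * (Gamma_series_euler' z n * Gamma_series_euler' (a - z) n) = (\<Prod>k=1..n. Q k)"
      by (simp only: Gamma_series_euler'_def prod.distrib)
  qed
  finally have Q: "(\<lambda>n. Q (Suc n)) has_prod G"
    using G by (intro has_prod_SucI) (simp_all add: G_def)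

  have "degenerate_Gamma lam z = of_real lam powr (- z) / (z * (a - z)) * (1 / Gamma a) * G"
    using nz assms(1) by (simp add: degenerate_Gamma_eq G_def a_def)
  thus ?thesis
    using P Q E
    unfolding a_def[symmetric] E_def[symmetric] by (simp add: has_prod_iff)
qed

end
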